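(* Let $n\ge 1$, let $f,g:\mathbb{R}^n\to[0,1]$ be measurable functions, and let $\lambda\in(0,1)$. Define $h_\lambda:\mathbb{R}^n\to[0,1]$ by $$h_\lambda(z)=\sup_{0<t<1}\ \sup_{z=(1-t)x+ty}\ \min\left\{f(x)^{\frac{1-t}{1-\lambda}},\ g(y)^{\frac{t}{\lambda}}\right\},$$ where the inner supremum is over all pairs $x,y\in\mathbb{R}^n$ with $z=(1-t)x+ty$. Then $$\int_{\mathbb{R}^n}h_\lambda\ \ge\ \left((1-\lambda)\left(\int_{\mathbb{R}^n}f\right)^{-1}+\lambda\left(\int_{\mathbb{R}^n}g\right)^{-1}\right)^{-1}.$$ The integral of $h_\lambda$ (which is not necessarily measurable) is interpreted as an upper integral.
   Context: Integrals are with respect to Lebesgue measure on $\mathbb{R}^n$. The upper integral of a nonnegative function $h$ is the infimum of $\int H$ over all measurable $H\ge h$. Inverses are taken in $[0,\infty]$ with the conventions $0^{-1}=\infty$ and $\infty^{-1}=0$. *)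

theory Defs
  imports "HOL-Analysis.Analysis"
begin

text \<open>\<^const>\<open>nn_integral\<close> is a supremum over simple functions below the integrand, so for
  non-measurable functions it is a lower integral; the upper integral has to be defined.\<close>

definition upper_nn_integral :: "'a measure \<Rightarrow> ('a \<Rightarrow> ennreal) \<Rightarrow> ennreal" where
  "upper_nn_integral M h =
     (INF H \<in> {H \<in> borel_measurable M. \<forall>x\<in>space M. h x \<le> H x}. \<integral>\<^sup>+ x. H x \<partial>M)"

text \<open>The suprema are taken in \<^typ>\<open>real\<close>: for \<^term>\<open>f\<close> and \<^term>\<open>g\<close> with values in $[0,1]$ and
  \<^prop>\<open>0 < l \<and> l < 1\<close> the index sets are nonempty and all values lie in $[0,1]$.  The exponents
  are positive there, so \<^term>\<open>0 powr a = (0::real)\<close> is the usual value.\<close>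

definition h_fun ::
  "('a::real_vector \<Rightarrow> real) \<Rightarrow> ('a \<Rightarrow> real) \<Rightarrow> real \<Rightarrow> 'a \<Rightarrow> real" where
  "h_fun f g l z =
     (SUP t \<in> {0<..<1}. SUP (x, y) \<in> {(x, y). z = (1 - t) *\<^sub>R x + t *\<^sub>R y}.
        min (f x powr ((1 - t) / (1 - l))) (g y powr (t / l)))"

end

theory Submission
  imports Defs "HOL-Real_Asymp.Real_Asymp"
begin

text \<open>The idea is to reduce the inequality to dimension one by measuring superlevel sets at the
  levels $e^{-1/u}$ with $u > 0$.  If $f(x) > e^{-1/u}$ and $g(y) > e^{-1/v}$, put
  $w = (1-l) u + l v$ and $t = l v / w$, so that $1 - t = (1-l) u / w$.  Then both
  $f(x)^{(1-t)/(1-l)}$ and $g(y)^{t/l}$ exceed $e^{-1/w}$, hence so does $h$ at the point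
  $(1-t) x + t y$ (lemma \<open>exp_recip_less_h_fun\<close>).  The parameter $t$, free in the definition of
  $h$, is exactly what makes the reciprocals $u, v$ of the logarithmic levels combine with the
  fixed weight $l$.

  By the multiplicative Brunn--Minkowski inequality, the set where $h > e^{-1/w}$ has measure at
  least $|\{f > e^{-1/u}\}|^{1-t} |\{g > e^{-1/v}\}|^t$.  The substitution $s = e^{-1/u}$ in the
  layer-cake formula turns the integral of $f$ into that of its \<open>level_profile\<close>
  $\phi_f(u) = |\{f > e^{-1/u}\}| e^{-1/u} u^{-2}$ over the half-line.  The weighted
  arithmetic--geometric mean inequality then yields
  $\phi_h((1-l) u + l v) \ge M(\phi_f(u), \phi_g(v))$, where $M$ is the weighted power mean
  of exponent $-1/2$ (lemma \<open>level_profile_power_mean_neg_half\<close>): the dependence of $t$ on $u$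
  and $v$ has disappeared.

  What remains is the one-dimensional Borell--Brascamp--Lieb inequality with exponent $-1/2$, whose
  conclusion is the harmonic mean.  It is obtained by dividing both functions by their suprema, so
  that the superlevel sets of both are nonempty at the same levels; there the additive
  Brunn--Minkowski inequality on the line applies (lemma \<open>mean_inequality_real\<close>), and the two
  suprema are eliminated by the Cauchy--Schwarz inequality.  The same lemma with the geometric
  mean in place of $M$ gives the Prekopa--Leindler inequality on the line; Fubini's theorem
  extends it to all dimensions, and indicator functions give the multiplicative Brunn--Minkowski
  inequality.

  Geometric means of extended nonnegative numbers do not appear.  A statement of the form
  $c \ge M(a, b)$ is expressed as: $M(p,q) \le c$ for all positive reals $p < a$ and $q < b$.  In
  this form infinite values and zeros of the functions and of their marginals need no
  case distinctions.\<close>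

section \<open>The Brunn--Minkowski inequality on the line\<close>

lemma cofinal_sequence_real:
  fixes A :: "real set"
  assumes "A \<noteq> {}"
  obtains a :: "nat \<Rightarrow> real"
    where "incseq a" "\<And>n. a n \<in> A" "\<And>x. x \<in> A \<Longrightarrow> \<exists>n. x \<le> a n"
proof (cases "\<exists>m\<in>A. \<forall>x\<in>A. x \<le> m")
  case True
  then obtain m where "m \<in> A" "\<forall>x\<in>A. x \<le> m" by blast
  then show ?thesis by (intro that[of "\<lambda>_. m"]) auto
next
  case False
  obtain u :: "nat \<Rightarrow> ereal" where u: "incseq u" "range u \<subseteq> ereal ` A" "Sup (ereal ` A) = (SUP i. u i)"
    using Sup_countable_SUP[of "ereal ` A"] assms by auto
  have "\<forall>n. \<exists>r\<in>A. u n = ereal r" using u(2) by auto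
  then obtain a where a: "\<And>n. a n \<in> A" "\<And>n. u n = ereal (a n)" by metis
  show ?thesis
  proof (rule that[of a])
    show "incseq a" using u(1) by (simp add: incseq_def a(2))
    show "a n \<in> A" for n by (rule a)
    fix x assume "x \<in> A"
    with False obtain y where y: "y \<in> A" "x < y" by force
    have "ereal x < Sup (ereal ` A)" using y by (intro less_le_trans[OF _ Sup_upper[of "ereal y"]]) auto
    then obtain n where "ereal x < u n" unfolding u(3) less_SUP_iff by blast
    then show "\<exists>n. x \<le> a n" by (auto simp: a(2) intro: less_imp_le)
  qed
qed

text \<open>For $a \in A$ and $b \in B$ the translates of $(1-t)(A \cap (-\infty,a])$ by $t b$ and of
  $t (B \cap [b,\infty))$ by $(1-t) a$ lie in \<open>C\<close> and meet at most in the
  point $(1-t) a + t b$.  Letting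
  \<open>a\<close> increase through \<open>A\<close> and \<open>b\<close> decrease through \<open>B\<close> exhausts both sets.  The measurable superset
  \<open>C\<close> takes the place of the Minkowski sum, which may fail to be measurable.\<close>

lemma brunn_minkowski_real:
  fixes A B C :: "real set" and t :: real
  assumes [measurable]: "A \<in> sets borel" "B \<in> sets borel" "C \<in> sets borel"
    and "A \<noteq> {}" "B \<noteq> {}" and t: "0 < t" "t < 1"
    and C: "\<And>a b. a \<in> A \<Longrightarrow> b \<in> B \<Longrightarrow> (1 - t) * a + t * b \<in> C"
  shows "ennreal (1 - t) * emeasure lborel A + ennreal t * emeasure lborel B \<le> emeasure lborel C"
proof -
  obtain u where u: "incseq u" "\<And>n. u n \<in> A" "\<And>x. x \<in> A \<Longrightarrow> \<exists>n. x \<le> u n"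
    using cofinal_sequence_real[OF \<open>A \<noteq> {}\<close>] by metis
  obtain v' where v': "incseq v'" "\<And>n. v' n \<in> uminus ` B" "\<And>x. x \<in> uminus ` B \<Longrightarrow> \<exists>n. x \<le> v' n"
    using cofinal_sequence_real[of "uminus ` B"] \<open>B \<noteq> {}\<close> by (metis image_is_empty)
  define v where "v = (\<lambda>n. - v' n)"
  have v: "decseq v" "\<And>n. v n \<in> B" "\<And>x. x \<in> B \<Longrightarrow> \<exists>n. v n \<le> x"
  proof -
    show "decseq v" using v'(1) by (auto simp: v_def incseq_def decseq_def)
    show "v n \<in> B" for n using v'(2)[of n] by (auto simp: v_def)
    show "\<exists>n. v n \<le> x" if "x \<in> B" for x
      using v'(3)[of "- x"] that by (auto simp: v_def minus_le_iff)
  qed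
  let ?A = "\<lambda>n. A \<inter> {..u n}" and ?B = "\<lambda>n. B \<inter> {v n..}"
  have step: "ennreal (1 - t) * emeasure lborel (?A n) + ennreal t * emeasure lborel (?B n)
      \<le> emeasure lborel C" for n
  proof -
    define z where "z = (1 - t) * u n + t * v n"
    let ?L = "C \<inter> {..z}" and ?R = "C \<inter> {z..}"
    have "ennreal (1 - t) * emeasure lborel (?A n)
        = ennreal \<bar>1 - t\<bar> * (\<integral>\<^sup>+x. indicator (?A n) x \<partial>lborel)" using t by simp
    also have "\<dots> \<le> ennreal \<bar>1 - t\<bar> * (\<integral>\<^sup>+x. indicator ?L (t * v n + (1 - t) * x) \<partial>lborel)"
      using C[OF _ v(2)[of n]] t
      by (intro mult_left_mono nn_integral_mono) (auto simp: indicator_def z_def add.commute)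
    also have "\<dots> = (\<integral>\<^sup>+x. indicator ?L x \<partial>lborel)"
      using t by (subst nn_integral_real_affine[of _ "1 - t" "t * v n"]) auto
    finally have 1: "ennreal (1 - t) * emeasure lborel (?A n) \<le> emeasure lborel ?L" by simp
    have "ennreal t * emeasure lborel (?B n)
        = ennreal \<bar>t\<bar> * (\<integral>\<^sup>+x. indicator (?B n) x \<partial>lborel)" using t by simp
    also have "\<dots> \<le> ennreal \<bar>t\<bar> * (\<integral>\<^sup>+x. indicator ?R ((1 - t) * u n + t * x) \<partial>lborel)"
      using C[OF u(2)[of n]] t
      by (intro mult_left_mono nn_integral_mono) (auto simp: indicator_def z_def algebra_simps)
    also have "\<dots> = (\<integral>\<^sup>+x. indicator ?R x \<partial>lborel)"
      using t by (subst nn_integral_real_affine[of _ t "(1 - t) * u n"]) auto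
    finally have 2: "ennreal t * emeasure lborel (?B n) \<le> emeasure lborel ?R" by simp
    have "emeasure lborel ?L + emeasure lborel ?R
        = emeasure lborel (?L \<union> ?R) + emeasure lborel (?L \<inter> ?R)"
      by (rule emeasure_Un_Int) auto
    moreover have "?L \<union> ?R = C" by auto
    moreover have "emeasure lborel (?L \<inter> ?R) \<le> emeasure lborel {z}"
      by (intro emeasure_mono) auto
    ultimately have "emeasure lborel ?L + emeasure lborel ?R = emeasure lborel C" by simp
    with add_mono[OF 1 2] show ?thesis by simp
  qed
  have "(\<lambda>n. emeasure lborel (?A n)) \<longlonglongrightarrow> emeasure lborel (\<Union>n. ?A n)"
    using u(1) by (intro Lim_emeasure_incseq) (auto simp: incseq_def intro: order_trans)
  moreover have "(\<Union>n. ?A n) = A" using u(3) by auto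
  moreover have "(\<lambda>n. emeasure lborel (?B n)) \<longlonglongrightarrow> emeasure lborel (\<Union>n. ?B n)"
    using v(1) by (intro Lim_emeasure_incseq) (auto simp: incseq_def decseq_def intro: order_trans)
  moreover have "(\<Union>n. ?B n) = B" using v(3) by auto
  ultimately have "(\<lambda>n. ennreal (1 - t) * emeasure lborel (?A n) + ennreal t * emeasure lborel (?B n))
      \<longlonglongrightarrow> ennreal (1 - t) * emeasure lborel A + ennreal t * emeasure lborel B"
    by (auto intro!: tendsto_add ennreal_tendsto_cmult)
  then show ?thesis by (rule LIMSEQ_le_const2) (use step in blast)
qed

section \<open>Integrals in terms of superlevel sets\<close>

text \<open>Fubini's theorem for the integrand $w(u)$ restricted to $\theta(u) < \phi(x)$; the hypothesis on
  \<open>w\<close> says that the measure with density \<open>w\<close> gives the set of those \<open>u\<close> the mass $\phi(x)$.\<close>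

lemma (in sigma_finite_measure) layer_cake:
  fixes \<phi> :: "'a \<Rightarrow> ennreal" and w \<theta> :: "real \<Rightarrow> ennreal"
  assumes [measurable]: "\<phi> \<in> borel_measurable M" "w \<in> borel_measurable borel" "\<theta> \<in> borel_measurable borel"
    and w: "\<And>x. x \<in> space M \<Longrightarrow> (\<integral>\<^sup>+u. w u * indicator {u. \<theta> u < \<phi> x} u \<partial>lborel) = \<phi> x"
  shows "(\<integral>\<^sup>+x. \<phi> x \<partial>M) = (\<integral>\<^sup>+u. w u * emeasure M {x \<in> space M. \<theta> u < \<phi> x} \<partial>lborel)"
proof -
  interpret pair_sigma_finite lborel M ..
  have "(\<integral>\<^sup>+x. \<phi> x \<partial>M) = (\<integral>\<^sup>+x. (\<integral>\<^sup>+u. w u * indicator {u. \<theta> u < \<phi> x} u \<partial>lborel) \<partial>M)"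
    using w by (simp cong: nn_integral_cong)
  also have "\<dots> = (\<integral>\<^sup>+u. (\<integral>\<^sup>+x. w u * indicator {u. \<theta> u < \<phi> x} u \<partial>M) \<partial>lborel)"
    by (rule Fubini') measurable
  also have "\<dots> = (\<integral>\<^sup>+u. (\<integral>\<^sup>+x. w u * indicator {x \<in> space M. \<theta> u < \<phi> x} x \<partial>M) \<partial>lborel)"
    by (intro nn_integral_cong) (auto simp: indicator_def)
  also have "\<dots> = (\<integral>\<^sup>+u. w u * emeasure M {x \<in> space M. \<theta> u < \<phi> x} \<partial>lborel)"
    by (intro nn_integral_cong nn_integral_cmult_indicator) measurable
  finally show ?thesis .
qed

lemma (in sigma_finite_measure) borel_measurable_emeasure_superlevel:
  fixes \<phi> :: "'a \<Rightarrow> ennreal" and \<theta> :: "real \<Rightarrow> ennreal"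
  assumes [measurable]: "\<phi> \<in> borel_measurable M" "\<theta> \<in> borel_measurable borel"
  shows "(\<lambda>u. emeasure M {x \<in> space M. \<theta> u < \<phi> x}) \<in> borel_measurable borel"
proof -
  have "(\<lambda>u. \<integral>\<^sup>+x. indicator {y. \<theta> u < y} (\<phi> x) \<partial>M) \<in> borel_measurable borel"
    by measurable
  also have "(\<lambda>u. \<integral>\<^sup>+x. indicator {y. \<theta> u < y} (\<phi> x) \<partial>M) = (\<lambda>u. \<integral>\<^sup>+x. indicator {x \<in> space M. \<theta> u < \<phi> x} x \<partial>M)"
    by (intro ext nn_integral_cong) (auto simp: indicator_def)
  finally show ?thesis by simp
qed

lemma nn_integral_eq_superlevel:
  fixes \<phi> :: "'a::euclidean_space \<Rightarrow> ennreal"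
  assumes [measurable]: "\<phi> \<in> borel_measurable borel"
  shows "(\<integral>\<^sup>+x. \<phi> x \<partial>lborel)
    = (\<integral>\<^sup>+s. indicator {0<..} s * emeasure lborel {x. ennreal s < \<phi> x} \<partial>lborel)"
proof -
  have "(\<integral>\<^sup>+s. indicator {0<..} s * indicator {s. ennreal s < y} s \<partial>lborel) = y" for y :: ennreal
  proof (cases y)
    case (real r)
    have "(\<integral>\<^sup>+s. indicator {0<..} s * indicator {s. ennreal s < y} s \<partial>lborel)
        = (\<integral>\<^sup>+s. indicator {0<..<r} s \<partial>lborel)"
      using real by (intro nn_integral_cong) (auto simp: indicator_def ennreal_less_iff)
    then show ?thesis using real by simp
  next
    case top
    have "(\<integral>\<^sup>+s. indicator {0<..} s * indicator {s. ennreal s < y} s \<partial>lborel)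
        = (\<integral>\<^sup>+s. indicator {0<..} s \<partial>(lborel :: real measure))"
      using top by (intro nn_integral_cong) (auto simp: indicator_def)
    also have "\<dots> = emeasure lborel {0::real<..}" by simp
    also have "\<dots> = top" 
    proof -
      have "of_nat n \<le> emeasure lborel {0::real<..}" for n
        using emeasure_mono[of "{0<..<real n}" "{0<..}" lborel]
        by (simp add: ennreal_of_nat_eq_real_of_nat subset_eq)
      then have "(SUP n. of_nat n) \<le> emeasure lborel {0::real<..}" by (intro SUP_least)
      then show ?thesis by (simp add: ennreal_SUP_of_nat_eq_top top_unique)
    qed
    finally show ?thesis using top by simp
  qed
  then show ?thesis
    using lborel.layer_cake[of \<phi> "indicator {0<..}" ennreal] by simp
qed


section \<open>Sup-normalised mean inequalities on the line\<close>

text \<open>After division by their suprema $\alpha$ and $\beta$, the functions \<open>f\<close> and \<open>g\<close> have nonempty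
  superlevel sets at every level $s < 1$, and homogeneity of \<open>M\<close> puts the combination of these sets
  into the superlevel set of $h / M(\alpha, \beta)$ at the same level.  Integrating the
  one-dimensional Brunn--Minkowski inequality over \<open>s\<close> gives the estimate.  Its left-hand side still
  contains the unknown $\alpha$ and $\beta$; every particular choice of \<open>M\<close> has its own
  inequality that removes them.\<close>

lemma mean_inequality_real:
  fixes f g h :: "real \<Rightarrow> ennreal" and M :: "real \<Rightarrow> real \<Rightarrow> real"
  assumes [measurable]: "f \<in> borel_measurable borel" "g \<in> borel_measurable borel" "h \<in> borel_measurable borel"
    and t: "0 < t" "t < 1"
    and M_pos: "\<And>a b. 0 < a \<Longrightarrow> 0 < b \<Longrightarrow> 0 < M a b"
    and M_hom: "\<And>s a b. 0 < s \<Longrightarrow> 0 < a \<Longrightarrow> 0 < b \<Longrightarrow> M (s * a) (s * b) = s * M a b"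
    and h: "\<And>x y p q. 0 < p \<Longrightarrow> 0 < q \<Longrightarrow> ennreal p < f x \<Longrightarrow> ennreal q < g y
               \<Longrightarrow> ennreal (M p q) \<le> h ((1 - t) * x + t * y)"
    and p: "0 \<le> p" "ennreal p < (\<integral>\<^sup>+x. f x \<partial>lborel)" 
    and q: "0 \<le> q" "ennreal q < (\<integral>\<^sup>+x. g x \<partial>lborel)"
  obtains \<alpha> \<beta> where "0 < \<alpha>" "0 < \<beta>"
    "ennreal (M \<alpha> \<beta> * ((1 - t) * (p / \<alpha>) + t * (q / \<beta>))) \<le> (\<integral>\<^sup>+x. h x \<partial>lborel)"
proof -
  \<comment> \<open>Unbounded functions are first truncated at a height that keeps the integral above \<open>p\<close>.\<close>
  have normalise: "\<exists>\<alpha> f'. 0 < \<alpha> \<and> f' \<in> borel_measurable borel \<and> (\<forall>x. ennreal \<alpha> * f' x \<le> f x)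
      \<and> (SUP x. f' x) = 1 \<and> ennreal (p / \<alpha>) \<le> (\<integral>\<^sup>+x. f' x \<partial>lborel)"
    if [measurable]: "f \<in> borel_measurable borel" and p: "0 \<le> p" "ennreal p < (\<integral>\<^sup>+x. f x \<partial>lborel)"
    for f :: "real \<Rightarrow> ennreal" and p
  proof -
    have "(SUP k. min (f x) (of_nat k)) = f x" for x
      by (simp add: inf_min[symmetric] inf_SUP[symmetric] ennreal_SUP_of_nat_eq_top)
    then have "(\<integral>\<^sup>+x. f x \<partial>lborel) = (\<integral>\<^sup>+x. (SUP k. min (f x) (of_nat k)) \<partial>lborel)" by simp
    also have "\<dots> = (SUP k. \<integral>\<^sup>+x. min (f x) (of_nat k) \<partial>lborel)"
      by (rule nn_integral_monotone_convergence_SUP)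
        (auto simp: incseq_def le_fun_def intro!: min.coboundedI2 of_nat_mono)
    finally have "ennreal p < (SUP k. \<integral>\<^sup>+x. min (f x) (of_nat k) \<partial>lborel)" using p(2) by simp
    then obtain k where k: "ennreal p < (\<integral>\<^sup>+x. min (f x) (of_nat k) \<partial>lborel)"
      by (auto simp: less_SUP_iff)
    define f1 where "f1 = (\<lambda>x. min (f x) (of_nat k))"
    have [measurable]: "f1 \<in> borel_measurable borel" unfolding f1_def by measurable
    define S where "S = (SUP x. f1 x)"
    have "S \<le> of_nat k" unfolding S_def f1_def by (intro SUP_least) auto
    then have S_top: "S < top" using ennreal_of_nat_neq_top[of k] by (metis less_top top.extremum_unique)
    have "S \<noteq> 0"
    proof
      assume "S = 0"
      then have "f1 x = 0" for x using SUP_upper[of x UNIV f1] by (simp add: S_def)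
      then have "(\<integral>\<^sup>+x. f1 x \<partial>lborel) = 0" by simp
      then show False using k by (simp add: f1_def)
    qed
    then obtain \<alpha> where \<alpha>: "0 < \<alpha>" "S = ennreal \<alpha>"
      using S_top by (cases S) (auto simp: less_le)
    have "ennreal \<alpha> * (f1 x / S) = f1 x" for x
      unfolding ennreal_times_divide \<alpha>(2) by (subst mult.commute) (use \<alpha>(1) in \<open>simp add: mult_divide_eq_ennreal\<close>)
    moreover have "(SUP x. f1 x / S) = S / S"
      by (simp add: S_def SUP_divide_ennreal)
    moreover have "S / S = 1" using \<alpha> by (simp add: divide_ennreal)
    moreover have "ennreal (p / \<alpha>) \<le> (\<integral>\<^sup>+x. f1 x / S \<partial>lborel)"
    proof -
      have "ennreal (p / \<alpha>) = ennreal p / S" using \<alpha> p by (simp add: divide_ennreal)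
      also have "\<dots> \<le> (\<integral>\<^sup>+x. f1 x \<partial>lborel) / S"
        using k by (intro divide_right_mono_ennreal) (simp add: f1_def)
      finally show ?thesis by (simp add: nn_integral_divide)
    qed
    ultimately show ?thesis
      using \<alpha> by (intro exI[of _ \<alpha>] exI[of _ "\<lambda>x. f1 x / S"]) (auto simp: f1_def)
  qed
  obtain \<alpha> f' where f': "0 < \<alpha>" "f' \<in> borel_measurable borel" "\<And>x. ennreal \<alpha> * f' x \<le> f x"
      "(SUP x. f' x) = 1" "ennreal (p / \<alpha>) \<le> (\<integral>\<^sup>+x. f' x \<partial>lborel)"
    using normalise[OF assms(1) p] by blast
  obtain \<beta> g' where g': "0 < \<beta>" "g' \<in> borel_measurable borel" "\<And>x. ennreal \<beta> * g' x \<le> g x"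
      "(SUP x. g' x) = 1" "ennreal (q / \<beta>) \<le> (\<integral>\<^sup>+x. g' x \<partial>lborel)"
    using normalise[OF assms(2) q] by blast
  note [measurable] = f'(2) g'(2)
  let ?c = "M \<alpha> \<beta>"
  have c: "0 < ?c" using M_pos f'(1) g'(1) by blast
  define h' where "h' = (\<lambda>x. h x / ennreal ?c)"
  have [measurable]: "h' \<in> borel_measurable borel" unfolding h'_def by measurable
  have h'_c: "ennreal ?c * h' x = h x" for x
    unfolding h'_def ennreal_times_divide by (subst mult.commute) (use c in \<open>simp add: mult_divide_eq_ennreal\<close>)
  have level: "ennreal (1 - t) * emeasure lborel {x. ennreal s < f' x} + ennreal t * emeasure lborel {x. ennreal s < g' x}
      \<le> emeasure lborel {x. ennreal s < h' x}" if s: "0 < s" for s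
  proof (cases "s < 1")
    case True
    show ?thesis
    proof (rule brunn_minkowski_real)
      have "ennreal s < (SUP x. f' x)" "ennreal s < (SUP x. g' x)"
        using True s unfolding f'(4) g'(4) by (simp_all add: ennreal_less_one_iff)
      then show "{x. ennreal s < f' x} \<noteq> {}" "{x. ennreal s < g' x} \<noteq> {}"
        unfolding less_SUP_iff by auto
      fix x y assume "x \<in> {x. ennreal s < f' x}" "y \<in> {x. ennreal s < g' x}"
      then have "ennreal s < min (f' x) (g' y)" by auto
      \<comment> \<open>The intermediate level \<open>s'\<close> makes up for the non-strict inequality assumed for \<open>h\<close>.\<close>
      then obtain r where r: "ennreal s < r" "r < min (f' x) (g' y)" using dense by blast
      then have "r < top" using less_top_ennreal order_less_trans by (metis top.not_eq_extremum)
      then obtain s' where s': "r = ennreal s'" "0 \<le> s'" by (cases r) auto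
      have ss: "s < s'" using r(1) s s' by (simp add: ennreal_less_iff)
      have "ennreal (s' * \<alpha>) < f x"
      proof -
        have "ennreal (s' * \<alpha>) = ennreal \<alpha> * ennreal s'"
          using s' f'(1) by (simp add: ennreal_mult mult.commute)
        also have "\<dots> < ennreal \<alpha> * f' x"
          using r(2) s' f'(1) by (intro ennreal_mult_strict_left_mono) auto
        finally show ?thesis using f'(3)[of x] by simp
      qed
      moreover have "ennreal (s' * \<beta>) < g y"
      proof -
        have "ennreal (s' * \<beta>) = ennreal \<beta> * ennreal s'"
          using s' g'(1) by (simp add: ennreal_mult mult.commute)
        also have "\<dots> < ennreal \<beta> * g' y"
          using r(2) s' g'(1) by (intro ennreal_mult_strict_left_mono) auto
        finally show ?thesis using g'(3)[of y] by simp
      qed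
      ultimately have "ennreal (M (s' * \<alpha>) (s' * \<beta>)) \<le> h ((1 - t) * x + t * y)"
        using s ss f'(1) g'(1) by (intro h) auto
      then have "ennreal (s' * ?c) \<le> h ((1 - t) * x + t * y)"
        using M_hom s ss f'(1) g'(1) by simp
      moreover have "ennreal s * ennreal ?c < ennreal (s' * ?c)"
        using s ss c by (simp add: ennreal_mult[symmetric] ennreal_less_iff)
      ultimately have "ennreal s * ennreal ?c < h ((1 - t) * x + t * y)" by order
      then show "(1 - t) * x + t * y \<in> {x. ennreal s < h' x}"
        using mult_left_mono[of "h' ((1 - t) * x + t * y)" "ennreal s" "ennreal ?c"]
        by (auto simp: h'_c not_le[symmetric] mult.commute)
    qed (use t in measurable)
  next
    case False
    have "\<not> ennreal s < f' x" "\<not> ennreal s < g' x" for x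
      using False SUP_upper[of x UNIV f'] SUP_upper[of x UNIV g'] f'(4) g'(4)
      by (auto simp: not_less intro: order_trans)
    then show ?thesis by simp
  qed
  have "ennreal (1 - t) * (\<integral>\<^sup>+x. f' x \<partial>lborel) + ennreal t * (\<integral>\<^sup>+x. g' x \<partial>lborel)
      = (\<integral>\<^sup>+s. ennreal (1 - t) * (indicator {0<..} s * emeasure lborel {x. ennreal s < f' x})
          + ennreal t * (indicator {0<..} s * emeasure lborel {x. ennreal s < g' x}) \<partial>lborel)"
    using lborel.borel_measurable_emeasure_superlevel[of f' ennreal]
      lborel.borel_measurable_emeasure_superlevel[of g' ennreal]
    by (simp add: nn_integral_eq_superlevel[of f'] nn_integral_eq_superlevel[of g'] nn_integral_add nn_integral_cmult)
  also have "\<dots> \<le> (\<integral>\<^sup>+s. indicator {0<..} s * emeasure lborel {x. ennreal s < h' x} \<partial>lborel)"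
    using level by (intro nn_integral_mono) (auto simp: indicator_def)
  also have "\<dots> = (\<integral>\<^sup>+x. h' x \<partial>lborel)" by (simp add: nn_integral_eq_superlevel[of h'])
  also have "\<dots> = (\<integral>\<^sup>+x. h x \<partial>lborel) / ennreal ?c" by (simp add: h'_def nn_integral_divide)
  finally have main: "ennreal (1 - t) * (\<integral>\<^sup>+x. f' x \<partial>lborel) + ennreal t * (\<integral>\<^sup>+x. g' x \<partial>lborel)
     \<le> (\<integral>\<^sup>+x. h x \<partial>lborel) / ennreal ?c" .
  have "ennreal (((1 - t) * (p / \<alpha>) + t * (q / \<beta>)))
      = ennreal (1 - t) * ennreal (p / \<alpha>) + ennreal t * ennreal (q / \<beta>)"
    using t p(1) q(1) f'(1) g'(1) by (simp add: ennreal_mult[symmetric] ennreal_plus[symmetric] del: ennreal_plus)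
  also have "\<dots> \<le> ennreal (1 - t) * (\<integral>\<^sup>+x. f' x \<partial>lborel) + ennreal t * (\<integral>\<^sup>+x. g' x \<partial>lborel)"
    by (intro add_mono mult_left_mono f' g') auto
  also note main
  finally have fin: "ennreal ((1 - t) * (p / \<alpha>) + t * (q / \<beta>)) \<le> (\<integral>\<^sup>+x. h x \<partial>lborel) / ennreal ?c" .
  have "ennreal (?c * ((1 - t) * (p / \<alpha>) + t * (q / \<beta>)))
      = ennreal ?c * ennreal ((1 - t) * (p / \<alpha>) + t * (q / \<beta>))"
    using c by (simp add: ennreal_mult')
  also have "\<dots> \<le> ennreal ?c * ((\<integral>\<^sup>+x. h x \<partial>lborel) / ennreal ?c)"
    by (intro mult_left_mono fin) auto
  also have "\<dots> = (\<integral>\<^sup>+x. h x \<partial>lborel)"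
    using c by (simp add: ennreal_times_divide mult_divide_eq_ennreal mult.commute)
  finally show thesis using that f'(1) g'(1) by blast
qed


section \<open>The Prekopa--Leindler and Brunn--Minkowski inequalities\<close>

text \<open>For the geometric mean, Young's inequality removes the suprema from \<open>mean_inequality_real\<close>.\<close>

lemma prekopa_leindler_real:
  fixes f g h :: "real \<Rightarrow> ennreal"
  assumes [measurable]: "f \<in> borel_measurable borel" "g \<in> borel_measurable borel" "h \<in> borel_measurable borel"
    and t: "0 < t" "t < 1"
    and h: "\<And>x y p q. 0 < p \<Longrightarrow> 0 < q \<Longrightarrow> ennreal p < f x \<Longrightarrow> ennreal q < g y
               \<Longrightarrow> ennreal (p powr (1 - t) * q powr t) \<le> h ((1 - t) * x + t * y)"
    and p: "0 < p" "ennreal p < (\<integral>\<^sup>+x. f x \<partial>lborel)" 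
    and q: "0 < q" "ennreal q < (\<integral>\<^sup>+x. g x \<partial>lborel)"
  shows "ennreal (p powr (1 - t) * q powr t) \<le> (\<integral>\<^sup>+x. h x \<partial>lborel)"
proof -
  define M where "M = (\<lambda>a b :: real. a powr (1 - t) * b powr t)"
  have M_hom: "M (s * a) (s * b) = s * M a b" if "0 < s" "0 < a" "0 < b" for s a b
    using that by (simp add: M_def powr_mult powr_add[symmetric] mult_ac)
  obtain \<alpha> \<beta> where ab: "0 < \<alpha>" "0 < \<beta>"
    and le: "ennreal (M \<alpha> \<beta> * ((1 - t) * (p / \<alpha>) + t * (q / \<beta>))) \<le> (\<integral>\<^sup>+x. h x \<partial>lborel)"
    using assms(1-3) t 
  proof (rule mean_inequality_real[where M=M])
    show "0 < M a b" if "0 < a" "0 < b" for a b using that by (simp add: M_def)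
  qed (use M_hom h p q in \<open>auto simp: M_def\<close>)
  have "p powr (1 - t) * q powr t = M \<alpha> \<beta> * ((p / \<alpha>) powr (1 - t) * (q / \<beta>) powr t)"
    using ab p q by (simp add: M_def powr_divide)
  also have "\<dots> \<le> M \<alpha> \<beta> * ((1 - t) * (p / \<alpha>) + t * (q / \<beta>))"
    using ab p q t by (intro mult_left_mono Youngs_inequality_0) (auto simp: M_def)
  finally show ?thesis using le by (meson ennreal_leI order_trans)
qed

text \<open>Induction on the number of coordinates: by the inequality on the line, the marginals of \<open>f\<close>, \<open>g\<close> and
  \<open>h\<close> in the new coordinate satisfy the hypothesis again, with the same \<open>t\<close>.\<close>

lemma prekopa_leindler_PiM:
  fixes f g h :: "('i \<Rightarrow> real) \<Rightarrow> ennreal" and t :: real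
  assumes "finite I" and t: "0 < t" "t < 1"
    and "f \<in> borel_measurable (\<Pi>\<^sub>M i\<in>I. lborel)" "g \<in> borel_measurable (\<Pi>\<^sub>M i\<in>I. lborel)"
      "h \<in> borel_measurable (\<Pi>\<^sub>M i\<in>I. lborel)"
    and "\<And>x y p q. x \<in> extensional I \<Longrightarrow> y \<in> extensional I \<Longrightarrow> 0 < p \<Longrightarrow> 0 < q
      \<Longrightarrow> ennreal p < f x \<Longrightarrow> ennreal q < g y
      \<Longrightarrow> ennreal (p powr (1 - t) * q powr t) \<le> h (\<lambda>i\<in>I. (1 - t) * x i + t * y i)"
    and "0 < p" "ennreal p < (\<integral>\<^sup>+x. f x \<partial>(\<Pi>\<^sub>M i\<in>I. lborel))"
    and "0 < q" "ennreal q < (\<integral>\<^sup>+x. g x \<partial>(\<Pi>\<^sub>M i\<in>I. lborel))"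
  shows "ennreal (p powr (1 - t) * q powr t) \<le> (\<integral>\<^sup>+x. h x \<partial>(\<Pi>\<^sub>M i\<in>I. lborel))"
  using assms(1,4-)
proof (induction I arbitrary: f g h p q rule: finite_induct)
  case empty
  interpret product_sigma_finite "\<lambda>_::'i. lborel :: real measure" ..
  have "ennreal p < f (\<lambda>_. undefined)" "ennreal q < g (\<lambda>_. undefined)"
    using empty.prems by (simp_all add: PiM_empty nn_integral_count_space_finite)
  then have "ennreal (p powr (1 - t) * q powr t) \<le> h (\<lambda>i\<in>{}. (1 - t) * undefined + t * undefined)"
    using empty.prems(5,7) by (intro empty.prems(4)) auto
  then show ?case by (simp add: restrict_def PiM_empty nn_integral_count_space_finite)
next
  case (insert i I)
  interpret product_sigma_finite "\<lambda>_::'i. lborel :: real measure" ..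
  interpret I: finite_product_sigma_finite "\<lambda>_::'i. lborel :: real measure" I
    by standard (rule insert.hyps)
  note [measurable] = insert.prems(1-3)
  have slice: "(\<lambda>s. k (x(i := s))) \<in> borel_measurable borel"
    if "k \<in> borel_measurable (\<Pi>\<^sub>M i\<in>insert i I. lborel)" "x \<in> extensional I"
    for k :: "('i \<Rightarrow> real) \<Rightarrow> ennreal" and x
  proof -
    have "x \<in> space (\<Pi>\<^sub>M i\<in>I. lborel)" using that(2) by (simp add: space_PiM PiE_UNIV_domain PiE_def)
    then have "(\<lambda>s. x(i := s)) \<in> measurable lborel (\<Pi>\<^sub>M i\<in>insert i I. lborel)"
      by (intro measurable_fun_upd[where J=I]) auto
    from measurable_compose[OF this that(1)] show ?thesis by simp
  qed
  have fubini: "(\<integral>\<^sup>+x. k x \<partial>(\<Pi>\<^sub>M i\<in>insert i I. lborel))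
      = (\<integral>\<^sup>+x. (\<integral>\<^sup>+s. k (x(i := s)) \<partial>lborel) \<partial>(\<Pi>\<^sub>M i\<in>I. lborel))"
    if "k \<in> borel_measurable (\<Pi>\<^sub>M i\<in>insert i I. lborel)" for k :: "('i \<Rightarrow> real) \<Rightarrow> ennreal"
    using product_nn_integral_insert[OF insert.hyps that] .
  have marginal: "(\<lambda>x. \<integral>\<^sup>+s. k (x(i := s)) \<partial>lborel) \<in> borel_measurable (\<Pi>\<^sub>M i\<in>I. lborel)"
    if [measurable]: "k \<in> borel_measurable (\<Pi>\<^sub>M i\<in>insert i I. lborel)" for k :: "('i \<Rightarrow> real) \<Rightarrow> ennreal"
    by measurable
  show ?case
    unfolding fubini[OF insert.prems(3)]
  proof (rule insert.IH)
    fix x y p q assume xy: "x \<in> extensional I" "y \<in> extensional I" and pq: "0 < p" "0 < q"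
      "ennreal p < (\<integral>\<^sup>+s. f (x(i := s)) \<partial>lborel)" "ennreal q < (\<integral>\<^sup>+s. g (y(i := s)) \<partial>lborel)"
    let ?z = "\<lambda>i\<in>I. (1 - t) * x i + t * y i"
    show "ennreal (p powr (1 - t) * q powr t) \<le> (\<integral>\<^sup>+s. h (?z(i := s)) \<partial>lborel)"
    proof (rule prekopa_leindler_real[where f="\<lambda>s. f (x(i := s))" and g="\<lambda>s. g (y(i := s))"])
      fix r s p q :: real assume "0 < p" "0 < q" "ennreal p < f (x(i := r))" "ennreal q < g (y(i := s))"
      then have "ennreal (p powr (1 - t) * q powr t)
          \<le> h (\<lambda>j\<in>insert i I. (1 - t) * (x(i := r)) j + t * (y(i := s)) j)"
        using xy by (intro insert.prems(4)) (auto simp: extensional_def simp del: fun_upd_apply, simp_all)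
      also have "(\<lambda>j\<in>insert i I. (1 - t) * (x(i := r)) j + t * (y(i := s)) j)
          = ?z(i := (1 - t) * r + t * s)"
        using insert.hyps by (auto simp: fun_eq_iff)
      finally show "ennreal (p powr (1 - t) * q powr t) \<le> h (?z(i := (1 - t) * r + t * s))" .
    qed (rule slice insert.prems(1-3) xy t pq restrict_extensional)+
  qed (rule marginal insert.prems(1-3,5,7) insert.prems(6)[unfolded fubini[OF insert.prems(1)]]
      insert.prems(8)[unfolded fubini[OF insert.prems(2)]])+
qed

lemma prekopa_leindler:
  fixes f g h :: "'a::euclidean_space \<Rightarrow> ennreal" and t :: real
  assumes [measurable]: "f \<in> borel_measurable borel" "g \<in> borel_measurable borel" "h \<in> borel_measurable borel"
    and t: "0 < t" "t < 1"
    and h: "\<And>x y p q. 0 < p \<Longrightarrow> 0 < q \<Longrightarrow> ennreal p < f x \<Longrightarrow> ennreal q < g y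
               \<Longrightarrow> ennreal (p powr (1 - t) * q powr t) \<le> h ((1 - t) *\<^sub>R x + t *\<^sub>R y)"
    and p: "0 < p" "ennreal p < (\<integral>\<^sup>+x. f x \<partial>lborel)" 
    and q: "0 < q" "ennreal q < (\<integral>\<^sup>+x. g x \<partial>lborel)"
  shows "ennreal (p powr (1 - t) * q powr t) \<le> (\<integral>\<^sup>+x. h x \<partial>lborel)"
proof -
  let ?P = "\<Pi>\<^sub>M b\<in>(Basis :: 'a set). (lborel :: real measure)"
  define e :: "('a \<Rightarrow> real) \<Rightarrow> 'a" where "e = (\<lambda>c. \<Sum>b\<in>Basis. c b *\<^sub>R b)"
  have [measurable]: "e \<in> measurable ?P borel" unfolding e_def by measurable
  have coords: "(\<integral>\<^sup>+x. k x \<partial>lborel) = (\<integral>\<^sup>+c. k (e c) \<partial>?P)"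
    if "k \<in> borel_measurable borel" for k :: "'a \<Rightarrow> ennreal"
    using that by (subst lborel_eq) (simp add: nn_integral_distr e_def[symmetric])
  show ?thesis
    unfolding coords[OF assms(3)]
  proof (rule prekopa_leindler_PiM[where f="\<lambda>c. f (e c)" and g="\<lambda>c. g (e c)"])
    fix c d p q assume "0 < p" "0 < q" "ennreal p < f (e c)" "ennreal q < g (e d)"
    then have "ennreal (p powr (1 - t) * q powr t) \<le> h ((1 - t) *\<^sub>R e c + t *\<^sub>R e d)" by (rule h)
    also have "(1 - t) *\<^sub>R e c + t *\<^sub>R e d = e (\<lambda>b\<in>Basis. (1 - t) * c b + t * d b)"
      by (simp add: e_def scaleR_sum_right sum.distrib[symmetric] scaleR_add_left)
    finally show "ennreal (p powr (1 - t) * q powr t) \<le> h (e (\<lambda>b\<in>Basis. (1 - t) * c b + t * d b))" .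
  qed (use t p q coords in auto)
qed

text \<open>Indicator functions in the Prekopa--Leindler inequality.  Positive lower bounds \<open>p\<close> and \<open>q\<close> for the
  measures allow sets of infinite measure.\<close>

lemma brunn_minkowski_multiplicative:
  fixes A B C :: "'a::euclidean_space set" and t :: real
  assumes [measurable]: "A \<in> sets borel" "B \<in> sets borel" "C \<in> sets borel"
    and t: "0 < t" "t < 1"
    and C: "\<And>a b. a \<in> A \<Longrightarrow> b \<in> B \<Longrightarrow> (1 - t) *\<^sub>R a + t *\<^sub>R b \<in> C"
    and p: "0 < p" "ennreal p < emeasure lborel A"
    and q: "0 < q" "ennreal q < emeasure lborel B"
  shows "ennreal (p powr (1 - t) * q powr t) \<le> emeasure lborel C"
proof -
  have "ennreal (p powr (1 - t) * q powr t) \<le> (\<integral>\<^sup>+x. indicator C x \<partial>lborel)"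
  proof (rule prekopa_leindler[where f="indicator A" and g="indicator B"])
    fix x y :: 'a and p q :: real
    assume pq: "0 < p" "0 < q" "ennreal p < indicator A x" "ennreal q < indicator B y"
    then have "x \<in> A" "y \<in> B" "p < 1" "q < 1" by (auto split: split_indicator_asm)
    moreover have "p powr (1 - t) * q powr t \<le> 1 * 1"
      using pq(1,2) \<open>p < 1\<close> \<open>q < 1\<close> t by (intro mult_mono powr_le1) auto
    ultimately show "ennreal (p powr (1 - t) * q powr t) \<le> indicator C ((1 - t) *\<^sub>R x + t *\<^sub>R y)"
      using C by simp
  qed (use t p q in auto)
  then show ?thesis by simp
qed

section \<open>The level substitution\<close>

definition exp_weight :: "real \<Rightarrow> real" where
  "exp_weight u = (if 0 < u then exp (- (1 / u)) / u\<^sup>2 else 0)"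

lemma exp_weight_nonneg: "0 \<le> exp_weight u"
  by (simp add: exp_weight_def)

lemma borel_measurable_exp_weight [measurable]: "exp_weight \<in> borel_measurable borel"
  unfolding exp_weight_def by measurable

text \<open>Differentiability at $0$ lets the fundamental theorem of calculus start there; it holds because
  $e^{-1/h}$ tends to $0$ faster than \<open>h\<close>.\<close>

lemma has_field_derivative_exp_recip:
  "((\<lambda>u. if 0 < u then exp (- (1 / u)) else 0) has_field_derivative exp_weight u) (at u)"
proof -
  let ?F = "\<lambda>u::real. if 0 < u then exp (- (1 / u)) else 0"
  consider "u > 0" | "u = 0" | "u < 0" by linarith
  then show ?thesis
  proof cases
    case 1
    have "((\<lambda>u. exp (- (1 / u))) has_field_derivative exp_weight u) (at u)"
      using 1 by (auto intro!: derivative_eq_intros simp: exp_weight_def power2_eq_square)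
    then show ?thesis
      by (rule has_field_derivative_transform_within_open[of _ _ _ "{0<..}"]) (use 1 in auto)
  next
    case 2
    have "((\<lambda>h::real. ?F h / h) \<longlongrightarrow> 0) (at_right 0)"
    proof (rule Lim_transform_eventually)
      show "((\<lambda>h::real. exp (- (1 / h)) / h) \<longlongrightarrow> 0) (at_right 0)" by real_asymp
    qed (auto simp: eventually_at_right_less eventually_at_filter)
    moreover have "((\<lambda>h::real. ?F h / h) \<longlongrightarrow> 0) (at_left 0)"
      by (rule Lim_transform_eventually[OF tendsto_const]) (auto simp: eventually_at_filter)
    ultimately have "((\<lambda>h::real. ?F h / h) \<longlongrightarrow> 0) (at 0)"
      by (simp add: filterlim_split_at)
    then show ?thesis using 2 by (simp add: DERIV_def exp_weight_def cong: if_cong)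
  next
    case 3
    have "((\<lambda>u. 0) has_field_derivative exp_weight u) (at u)"
      using 3 by (simp add: exp_weight_def)
    then show ?thesis
      by (rule has_field_derivative_transform_within_open[of _ _ _ "{..<0}"]) (use 3 in auto)
  qed
qed

text \<open>This is the substitution $s = e^{-1/u}$, whose density is \<open>exp_weight\<close>: the condition
  $e^{-1/u} < y$ means $u < -1/\ln y$.\<close>

lemma nn_integral_exp_weight:
  assumes "0 \<le> y" "y \<le> 1"
  shows "(\<integral>\<^sup>+u. ennreal (exp_weight u) * indicator {u. ennreal (exp (- (1 / u))) < ennreal y} u \<partial>lborel) = ennreal y"
proof -
  let ?F = "\<lambda>u::real. if 0 < u then exp (- (1 / u)) else 0"
  consider "y = 0" | "0 < y" "y < 1" | "y = 1" using assms by linarith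
  then show ?thesis
  proof cases
    case 1 then show ?thesis by simp
  next
    case 2
    define b where "b = - 1 / ln y"
    have b: "0 < b" using 2 by (simp add: b_def divide_neg_neg)
    have "(\<integral>\<^sup>+u. ennreal (exp_weight u) * indicator {u. ennreal (exp (- (1 / u))) < ennreal y} u \<partial>lborel)
       = (\<integral>\<^sup>+u. ennreal (exp_weight u) * indicator {0..b} u \<partial>lborel)"
    proof (rule nn_integral_cong_AE)
      have iff: "exp (- (1 / u)) < y \<longleftrightarrow> u < b" if "0 < u" for u
      proof -
        have "exp (- (1 / u)) < y \<longleftrightarrow> - (1 / u) < ln y"
          using 2 by (metis exp_less_cancel_iff exp_ln)
        also have "\<dots> \<longleftrightarrow> u < b"
          using that 2 unfolding b_def by (simp add: field_simps ln_less_zero)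
        finally show ?thesis .
      qed
      show "AE u in lborel. ennreal (exp_weight u) * indicator {u. ennreal (exp (- (1 / u))) < ennreal y} u
          = ennreal (exp_weight u) * indicator {0..b} u"
        using AE_lborel_singleton[of b]
        by eventually_elim (auto simp: indicator_def exp_weight_def ennreal_less_iff iff)
    qed
    also have "\<dots> = ennreal (?F b - ?F 0)"
      using b by (intro nn_integral_FTC_Icc)
        (auto intro!: has_field_derivative_exp_recip exp_weight_nonneg)
    also have "?F b - ?F 0 = y" using 2 b by (simp add: b_def)
    finally show ?thesis .
  next
    case 3
    have "(\<integral>\<^sup>+u. ennreal (exp_weight u) * indicator {u. ennreal (exp (- (1 / u))) < ennreal y} u \<partial>lborel)
       = (\<integral>\<^sup>+u. ennreal (exp_weight u) * indicator {0..} u \<partial>lborel)"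
      using 3 by (intro nn_integral_cong) (auto simp: indicator_def exp_weight_def)
    also have "\<dots> = ennreal (1 - ?F 0)"
    proof (rule nn_integral_FTC_atLeast[where F="?F" and T=1])
      show "(?F \<longlongrightarrow> 1) at_top"
      proof (rule Lim_transform_eventually)
        show "((\<lambda>u::real. exp (- (1 / u))) \<longlongrightarrow> 1) at_top" by real_asymp
        show "\<forall>\<^sub>F u::real in at_top. exp (- (1 / u)) = ?F u"
          using eventually_gt_at_top[of 0] by eventually_elim auto
      qed
    qed (auto intro!: has_field_derivative_exp_recip exp_weight_nonneg)
    finally show ?thesis using 3 by simp
  qed
qed

text \<open>The integrand of the layer-cake formula in the variable \<open>u\<close> with $s = e^{-1/u}$.\<close>

definition level_profile :: "('a::euclidean_space \<Rightarrow> ennreal) \<Rightarrow> real \<Rightarrow> ennreal" where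
  "level_profile \<phi> u = ennreal (exp_weight u) * emeasure lborel {x. ennreal (exp (- (1 / u))) < \<phi> x}"

lemma borel_measurable_level_profile:
  assumes "\<phi> \<in> borel_measurable borel"
  shows "level_profile \<phi> \<in> borel_measurable borel"
proof -
  have "(\<lambda>u. emeasure lborel {x \<in> space lborel. ennreal (exp (- (1 / u))) < \<phi> x}) \<in> borel_measurable borel"
    by (intro lborel.borel_measurable_emeasure_superlevel) (use assms in measurable)
  then show ?thesis unfolding level_profile_def by simp
qed

lemma nn_integral_level_profile:
  assumes [measurable]: "\<phi> \<in> borel_measurable borel" and "\<And>x. \<phi> x \<le> 1"
  shows "(\<integral>\<^sup>+u. level_profile \<phi> u \<partial>lborel) = (\<integral>\<^sup>+x. \<phi> x \<partial>lborel)"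
proof -
  have "(\<integral>\<^sup>+u. ennreal (exp_weight u) * indicator {u. ennreal (exp (- (1 / u))) < \<phi> x} u \<partial>lborel) = \<phi> x" for x
  proof -
    obtain y where "\<phi> x = ennreal y" "0 \<le> y" using assms(2)[of x] by (cases "\<phi> x") (auto simp: top_unique)
    then show ?thesis using assms(2)[of x] nn_integral_exp_weight[of y] by simp
  qed
  then show ?thesis
    using lborel.layer_cake[of \<phi> "\<lambda>u. ennreal (exp_weight u)" "\<lambda>u. ennreal (exp (- (1 / u)))"]
    by (simp add: level_profile_def)
qed

section \<open>The power mean of exponent -1/2\<close>

definition power_mean_neg_half :: "real \<Rightarrow> real \<Rightarrow> real \<Rightarrow> real" where
  "power_mean_neg_half l a b = 1 / ((1 - l) / sqrt a + l / sqrt b)\<^sup>2"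

text \<open>The weights satisfy $(1-\tau) (p u^2)^{-1/2} = (1-l) p^{-1/2} / w$ and
  $\tau (q v^2)^{-1/2} = l q^{-1/2} / w$.  Young's inequality for the inverse square roots of
  $p u^2$ and $q v^2$ thus replaces the weights $1-\tau$ and $\tau$ by the constant $1-l$ and $l$.\<close>

lemma power_mean_neg_half_le_geometric:
  assumes "0 < l" "l < 1" and pos: "0 < p" "0 < q" "0 < u" "0 < v"
    and w: "w = (1 - l) * u + l * v" and \<tau>: "\<tau> = l * v / w"
  shows "power_mean_neg_half l p q \<le> (p * u\<^sup>2) powr (1 - \<tau>) * (q * v\<^sup>2) powr \<tau> / w\<^sup>2"
proof -
  have w0: "0 < w" using assms by (simp add: add_pos_pos)
  have \<tau>': "1 - \<tau> = (1 - l) * u / w" "0 < \<tau>" "\<tau> < 1"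
  proof -
    show 1: "1 - \<tau> = (1 - l) * u / w" using w0 w \<tau> by (simp add: field_simps)
    show "0 < \<tau>" using w0 assms by simp
    have "0 < 1 - \<tau>" unfolding 1 using w0 assms by simp
    then show "\<tau> < 1" by simp
  qed
  define G where "G = (p * u\<^sup>2) powr (1 - \<tau>) * (q * v\<^sup>2) powr \<tau>"
  define T where "T = (1 - l) / sqrt p + l / sqrt q"
  have G: "0 < G" and T: "0 < T" using assms by (auto simp: G_def T_def intro!: add_pos_pos)
  have "1 / sqrt G = (1 / (sqrt p * u)) powr (1 - \<tau>) * (1 / (sqrt q * v)) powr \<tau>"
  proof -
    have "sqrt G = (sqrt p * u) powr (1 - \<tau>) * (sqrt q * v) powr \<tau>"
    proof (rule real_sqrt_unique)
      have "((sqrt p * u) powr (1 - \<tau>))\<^sup>2 = (p * u\<^sup>2) powr (1 - \<tau>)"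
        using pos by (simp add: power2_eq_square powr_mult[symmetric] algebra_simps)
      moreover have "((sqrt q * v) powr \<tau>)\<^sup>2 = (q * v\<^sup>2) powr \<tau>"
        using pos by (simp add: power2_eq_square powr_mult[symmetric] algebra_simps)
      ultimately show "((sqrt p * u) powr (1 - \<tau>) * (sqrt q * v) powr \<tau>)\<^sup>2 = G"
        by (simp add: power_mult_distrib G_def)
    qed simp
    then show ?thesis using pos by (simp add: powr_divide)
  qed
  also have "\<dots> \<le> (1 - \<tau>) * (1 / (sqrt p * u)) + \<tau> * (1 / (sqrt q * v))"
    using \<tau>' pos by (intro Youngs_inequality_0) auto
  also have "\<dots> = T / w"
  proof -
    have "(1 - \<tau>) * (1 / (sqrt p * u)) = (1 - l) / sqrt p / w" unfolding \<tau>'(1) using pos by simp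
    moreover have "\<tau> * (1 / (sqrt q * v)) = l / sqrt q / w" unfolding \<tau> using pos by simp
    ultimately show ?thesis by (simp add: T_def add_divide_distrib)
  qed
  finally have "(1 / sqrt G)\<^sup>2 \<le> (T / w)\<^sup>2" using G by (intro power_mono) auto
  then have "1 / G \<le> T\<^sup>2 / w\<^sup>2" using G by (simp add: power_divide)
  then have "1 / T\<^sup>2 \<le> G / w\<^sup>2" using G T w0 by (simp add: field_simps)
  then show ?thesis by (simp add: power_mean_neg_half_def G_def T_def)
qed

text \<open>The Cauchy--Schwarz inequality
  $((1-l) a^{-1/2} + l b^{-1/2})^2 \le ((1-l)/p + l/q) ((1-l) p/a + l q/b)$, which eliminates
  \<open>a\<close> and \<open>b\<close> from the conclusion of \<open>mean_inequality_real\<close>.\<close>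

lemma harmonic_mean_le_power_mean_neg_half:
  assumes l: "0 < l" "l < 1" and pos: "0 < p" "0 < q" "0 < a" "0 < b"
  shows "1 / ((1 - l) / p + l / q) \<le> power_mean_neg_half l a b * ((1 - l) * (p / a) + l * (q / b))"
proof -
  define T where "T = (1 - l) / sqrt a + l / sqrt b"
  define X where "X = (1 - l) / p + l / q"
  define Y where "Y = (1 - l) * (p / a) + l * (q / b)"
  have TX: "0 < T" "0 < X" using assms by (auto simp: T_def X_def intro!: add_pos_pos)
  have "T\<^sup>2 \<le> X * Y"
  proof -
    \<comment> \<open>Lagrange's identity\<close>
    have "X * Y - T\<^sup>2 = (1 - l) * l * (sqrt (p / (q * a)) - sqrt (q / (p * b)))\<^sup>2"
    proof -
      obtain x y r s where xs: "0 < x" "0 < y" "0 < r" "0 < s" "p = x\<^sup>2" "q = y\<^sup>2" "a = r\<^sup>2" "b = s\<^sup>2"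
        using that[of "sqrt p" "sqrt q" "sqrt a" "sqrt b"] pos by simp
      show ?thesis
        using xs by (simp add: X_def Y_def T_def real_sqrt_divide real_sqrt_mult)
          (simp add: field_simps power2_eq_square)
    qed
    then show ?thesis using l by (smt (verit) mult_nonneg_nonneg zero_le_power2)
  qed
  then have "1 / X \<le> Y / T\<^sup>2" using TX by (simp add: field_simps)
  then show ?thesis by (simp add: power_mean_neg_half_def T_def X_def Y_def)
qed


section \<open>The harmonic mean inequality for level sets\<close>

lemma less_level_profileD:
  assumes "0 < p" "ennreal p < level_profile \<phi> u"
  shows "0 < u" "ennreal (p * u\<^sup>2 * exp (1 / u)) < emeasure lborel {x. ennreal (exp (- (1 / u))) < \<phi> x}"
proof -
  show u: "0 < u"
    using assms by (rule_tac ccontr) (simp add: level_profile_def exp_weight_def)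
  let ?a = "p * u\<^sup>2 * exp (1 / u)"
  have "exp_weight u * ?a = p * (exp (- (1 / u)) * exp (1 / u))"
    using u by (simp add: exp_weight_def)
  also have "\<dots> = p" by (simp add: exp_add[symmetric])
  finally have "ennreal p = ennreal (exp_weight u) * ennreal ?a"
    by (metis ennreal_mult' exp_weight_nonneg)
  then show "ennreal ?a < emeasure lborel {x. ennreal (exp (- (1 / u))) < \<phi> x}"
    using assms(2) mult_left_mono[of _ "ennreal ?a" "ennreal (exp_weight u)"]
    by (metis level_profile_def not_le zero_le)
qed

text \<open>The Brunn--Minkowski inequality bounds the measure of the superlevel set of \<open>h\<close> by a geometric mean
  with weights depending on \<open>u\<close> and \<open>v\<close>.  Since $(1-\tau)/u + \tau/v = 1/w$, the factors
  $e^{-1/u}$, $e^{-1/v}$ and $e^{-1/w}$ of the level profiles cancel, and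
  \<open>power_mean_neg_half_le_geometric\<close> absorbs the factors $u^{-2}$, $v^{-2}$ and $w^{-2}$.\<close>

lemma level_profile_power_mean_neg_half:
  fixes f g h :: "'a::euclidean_space \<Rightarrow> ennreal"
  assumes [measurable]: "f \<in> borel_measurable borel" "g \<in> borel_measurable borel" "h \<in> borel_measurable borel"
    and l: "0 < l" "l < 1"
    and h: "\<And>u v w x y. 0 < u \<Longrightarrow> 0 < v \<Longrightarrow> w = (1 - l) * u + l * v
      \<Longrightarrow> ennreal (exp (- (1 / u))) < f x \<Longrightarrow> ennreal (exp (- (1 / v))) < g y
      \<Longrightarrow> ennreal (exp (- (1 / w))) < h ((1 - l * v / w) *\<^sub>R x + (l * v / w) *\<^sub>R y)"
    and p: "0 < p" "ennreal p < level_profile f u"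
    and q: "0 < q" "ennreal q < level_profile g v"
  shows "ennreal (power_mean_neg_half l p q) \<le> level_profile h ((1 - l) * u + l * v)"
proof -
  note u = less_level_profileD[OF p] and v = less_level_profileD[OF q]
  define w where "w = (1 - l) * u + l * v"
  define \<tau> where "\<tau> = l * v / w"
  have w0: "0 < w" using u(1) v(1) l by (simp add: w_def add_pos_pos)
  have \<tau>1: "1 - \<tau> = (1 - l) * u / w" using w0 by (simp add: \<tau>_def w_def field_simps)
  have \<tau>: "0 < \<tau>" "\<tau> < 1"
  proof -
    show "0 < \<tau>" using w0 l v(1) by (simp add: \<tau>_def)
    have "0 < 1 - \<tau>" unfolding \<tau>1 using w0 l u(1) by simp
    then show "\<tau> < 1" by simp
  qed
  let ?P = "p * u\<^sup>2" and ?Q = "q * v\<^sup>2"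
  have bm: "ennreal ((?P * exp (1 / u)) powr (1 - \<tau>) * (?Q * exp (1 / v)) powr \<tau>)
      \<le> emeasure lborel {z. ennreal (exp (- (1 / w))) < h z}"
  proof (rule brunn_minkowski_multiplicative[OF _ _ _ \<tau> _ _ u(2) _ v(2)])
    fix a b assume "a \<in> {x. ennreal (exp (- (1 / u))) < f x}" "b \<in> {x. ennreal (exp (- (1 / v))) < g x}"
    then show "(1 - \<tau>) *\<^sub>R a + \<tau> *\<^sub>R b \<in> {z. ennreal (exp (- (1 / w))) < h z}"
      using h[OF u(1) v(1) w_def] by (simp add: \<tau>_def)
  qed (use p q u v in auto)
  have P_eq: "(?P * exp (1 / u)) powr (1 - \<tau>) * (?Q * exp (1 / v)) powr \<tau>
      = ?P powr (1 - \<tau>) * ?Q powr \<tau> * exp (1 / w)"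
  proof -
    have "exp (1 / u) powr (1 - \<tau>) * exp (1 / v) powr \<tau> = exp ((1 - \<tau>) / u + \<tau> / v)"
      by (simp add: exp_powr_real exp_add[symmetric])
    also have "(1 - \<tau>) / u + \<tau> / v = 1 / w"
      unfolding \<tau>1 using u(1) v(1) w0 by (simp add: \<tau>_def field_simps)
    finally have "exp (1 / w) = exp (1 / u) powr (1 - \<tau>) * exp (1 / v) powr \<tau>" by simp
    then show ?thesis using p q by (simp only: powr_mult mult_ac)
  qed
  have "power_mean_neg_half l p q \<le> exp_weight w * (?P powr (1 - \<tau>) * ?Q powr \<tau> * exp (1 / w))"
  proof -
    have "exp_weight w * (?P powr (1 - \<tau>) * ?Q powr \<tau> * exp (1 / w))
        = ?P powr (1 - \<tau>) * ?Q powr \<tau> / w\<^sup>2 * (exp (- (1 / w)) * exp (1 / w))"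
      using w0 by (simp add: exp_weight_def)
    also have "\<dots> = ?P powr (1 - \<tau>) * ?Q powr \<tau> / w\<^sup>2" by (simp add: exp_add[symmetric])
    finally show ?thesis
      using power_mean_neg_half_le_geometric[OF l p(1) q(1) u(1) v(1) w_def \<tau>_def] by simp
  qed
  then have "ennreal (power_mean_neg_half l p q)
      \<le> ennreal (exp_weight w * (?P powr (1 - \<tau>) * ?Q powr \<tau> * exp (1 / w)))"
    by (intro ennreal_leI)
  also have "\<dots> = ennreal (exp_weight w) * ennreal (?P powr (1 - \<tau>) * ?Q powr \<tau> * exp (1 / w))"
    by (rule ennreal_mult'[OF exp_weight_nonneg])
  also have "\<dots> \<le> ennreal (exp_weight w) * emeasure lborel {z. ennreal (exp (- (1 / w))) < h z}"
    unfolding P_eq[symmetric] by (intro mult_left_mono bm) simp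
  finally show ?thesis by (simp add: level_profile_def w_def)
qed

lemma nn_integral_harmonic_real:
  fixes f g h :: "'a::euclidean_space \<Rightarrow> ennreal"
  assumes [measurable]: "f \<in> borel_measurable borel" "g \<in> borel_measurable borel" "h \<in> borel_measurable borel"
    and le1: "\<And>x. f x \<le> 1" "\<And>x. g x \<le> 1" "\<And>x. h x \<le> 1"
    and l: "0 < l" "l < 1"
    and h: "\<And>u v w x y. 0 < u \<Longrightarrow> 0 < v \<Longrightarrow> w = (1 - l) * u + l * v
      \<Longrightarrow> ennreal (exp (- (1 / u))) < f x \<Longrightarrow> ennreal (exp (- (1 / v))) < g y
      \<Longrightarrow> ennreal (exp (- (1 / w))) < h ((1 - l * v / w) *\<^sub>R x + (l * v / w) *\<^sub>R y)"
    and p: "0 < p" "ennreal p < (\<integral>\<^sup>+x. f x \<partial>lborel)"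
    and q: "0 < q" "ennreal q < (\<integral>\<^sup>+x. g x \<partial>lborel)"
  shows "ennreal (1 / ((1 - l) / p + l / q)) \<le> (\<integral>\<^sup>+x. h x \<partial>lborel)"
proof -
  have pos: "0 < (1 - l) / sqrt a + l / sqrt b" if "0 < a" "0 < b" for a b
    using that l by (intro add_pos_pos) auto
  obtain \<alpha> \<beta> where ab: "0 < \<alpha>" "0 < \<beta>" and
    "ennreal (power_mean_neg_half l \<alpha> \<beta> * ((1 - l) * (p / \<alpha>) + l * (q / \<beta>))) \<le> (\<integral>\<^sup>+u. level_profile h u \<partial>lborel)"
  proof (rule mean_inequality_real[where M="power_mean_neg_half l" and t=l and f="level_profile f" and g="level_profile g" and h="level_profile h" and p=p and q=q])
    show "0 < power_mean_neg_half l a b" if "0 < a" "0 < b" for a b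
      using pos[OF that] by (simp add: power_mean_neg_half_def)
    show "power_mean_neg_half l (s * a) (s * b) = s * power_mean_neg_half l a b" if "0 < s" "0 < a" "0 < b" for s a b
    proof -
      have "(1 - l) / sqrt (s * a) + l / sqrt (s * b) = ((1 - l) / sqrt a + l / sqrt b) / sqrt s"
        using that by (simp add: real_sqrt_mult add_divide_distrib mult.commute)
      then show ?thesis using that by (simp add: power_mean_neg_half_def power_divide)
    qed
    show "ennreal (power_mean_neg_half l p q) \<le> level_profile h ((1 - l) * u + l * v)"
      if "0 < p" "0 < q" "ennreal p < level_profile f u" "ennreal q < level_profile g v" for u v p q
      by (rule level_profile_power_mean_neg_half[OF assms(1-3) l h that(1,3,2,4)])
  qed (use l p q in \<open>auto simp: nn_integral_level_profile le1 intro!: borel_measurable_level_profile\<close>)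
  then show ?thesis
    using ennreal_leI[OF harmonic_mean_le_power_mean_neg_half[OF l p(1) q(1) ab]]
    by (simp add: nn_integral_level_profile le1 order_trans)
qed

text \<open>Approximation of \<open>P\<close> and \<open>Q\<close> from below by positive reals; inversion is continuous on the extended
  nonnegative numbers, including at infinity.\<close>

lemma ennreal_harmonic_mean_leI:
  fixes P Q K :: ennreal
  assumes l: "0 < l" "l < 1"
    and K: "\<And>p q. 0 < p \<Longrightarrow> 0 < q \<Longrightarrow> ennreal p < P \<Longrightarrow> ennreal q < Q
      \<Longrightarrow> ennreal (1 / ((1 - l) / p + l / q)) \<le> K"
  shows "inverse (ennreal (1 - l) * inverse P + ennreal l * inverse Q) \<le> K"
proof (cases "P = 0 \<or> Q = 0")
  case True
  then show ?thesis using l by (auto simp: ennreal_mult_top)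
next
  case False
  obtain u where u: "\<And>n. u n < P" "u \<longlonglongrightarrow> P"
    using approx_from_below_dense_linorder[of 0 P] False by (auto simp: zero_less_iff_neq_zero)
  obtain v where v: "\<And>n. v n < Q" "v \<longlonglongrightarrow> Q"
    using approx_from_below_dense_linorder[of 0 Q] False by (auto simp: zero_less_iff_neq_zero)
  have inv: "((\<lambda>n. inverse (s n)) \<longlonglongrightarrow> inverse S)" if "s \<longlonglongrightarrow> S" for s and S :: ennreal
    using continuous_on_tendsto_compose[OF continuous_on_inverse_ennreal[OF continuous_on_id] that, of UNIV] by simp
  have "(\<lambda>n. inverse (ennreal (1 - l) * inverse (u n) + ennreal l * inverse (v n)))
      \<longlonglongrightarrow> inverse (ennreal (1 - l) * inverse P + ennreal l * inverse Q)"
    by (intro inv tendsto_add ennreal_tendsto_cmult u v) auto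
  moreover have "\<forall>\<^sub>F n in sequentially. inverse (ennreal (1 - l) * inverse (u n) + ennreal l * inverse (v n)) \<le> K"
  proof -
    have "\<forall>\<^sub>F n in sequentially. 0 < u n" "\<forall>\<^sub>F n in sequentially. 0 < v n"
      using order_tendstoD(1)[OF u(2), of 0] order_tendstoD(1)[OF v(2), of 0] False
      by (auto simp: zero_less_iff_neq_zero)
    then show ?thesis
    proof eventually_elim
      case (elim n)
      obtain p where p: "u n = ennreal p" "0 < p"
        using elim(1) u(1)[of n] by (cases "u n") (auto simp: less_le top_unique)
      obtain q where q: "v n = ennreal q" "0 < q"
        using elim(2) v(1)[of n] by (cases "v n") (auto simp: less_le top_unique)
      have "0 < (1 - l) / p + l / q" using l p q by (intro add_pos_pos) auto
      then have "inverse (ennreal (1 - l) * inverse (u n) + ennreal l * inverse (v n))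
          = ennreal (1 / ((1 - l) / p + l / q))"
        using p q l by (simp add: inverse_ennreal ennreal_mult'[symmetric] ennreal_plus[symmetric]
          divide_inverse del: ennreal_plus)
      also have "\<dots> \<le> K" using p q u(1)[of n] v(1)[of n] by (intro K) auto
      finally show ?case .
    qed
  qed
  ultimately show ?thesis by (intro tendsto_upperbound) auto
qed

section \<open>From Lebesgue to Borel functions\<close>

text \<open>The argument above is about Borel functions, and a Borel function that merely agrees almost
  everywhere with \<open>f\<close> would not respect the pointwise supremum defining $h$.  Lowering \<open>f\<close> to zero on
  a null set, and raising a majorant of $h$ to infinity on one, preserves the pointwise inequality.\<close>

lemma lebesgue_borel_minorant:
  fixes \<phi> :: "'a::euclidean_space \<Rightarrow> ennreal"
  assumes "\<phi> \<in> borel_measurable lebesgue"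
  obtains \<psi> where "\<psi> \<in> borel_measurable borel" "\<And>x. \<psi> x \<le> \<phi> x"
    "(\<integral>\<^sup>+x. \<psi> x \<partial>lborel) = (\<integral>\<^sup>+x. \<phi> x \<partial>lebesgue)"
proof -
  obtain \<phi>' where \<phi>': "\<phi>' \<in> borel_measurable lborel" "AE x in lborel. \<phi> x = \<phi>' x"
    using completion_ex_borel_measurable[OF assms] by blast
  obtain N where N: "N \<in> null_sets lborel" "{x \<in> space lborel. \<phi> x \<noteq> \<phi>' x} \<subseteq> N"
    using AE_E[OF \<phi>'(2)] by (metis null_setsI)
  have eq: "\<phi> x = \<phi>' x" if "x \<notin> N" for x using N(2) that by auto
  have [measurable]: "N \<in> sets borel" "\<phi>' \<in> borel_measurable borel" using N \<phi>' by auto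
  show ?thesis
  proof (rule that[of "\<lambda>x. \<phi>' x * indicator (- N) x"])
    show "\<phi>' x * indicator (- N) x \<le> \<phi> x" for x
      by (cases "x \<in> N") (simp_all add: eq)
    have "(\<integral>\<^sup>+x. \<phi>' x * indicator (- N) x \<partial>lborel) = (\<integral>\<^sup>+x. \<phi> x \<partial>lborel)"
      using \<phi>'(2) AE_not_in[OF N(1)] by (intro nn_integral_cong_AE) (auto elim: eventually_elim2)
    then show "(\<integral>\<^sup>+x. \<phi>' x * indicator (- N) x \<partial>lborel) = (\<integral>\<^sup>+x. \<phi> x \<partial>lebesgue)"
      by (simp add: nn_integral_completion)
  qed measurable
qed

lemma lebesgue_borel_majorant:
  fixes \<phi> :: "'a::euclidean_space \<Rightarrow> ennreal"
  assumes "\<phi> \<in> borel_measurable lebesgue"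
  obtains \<psi> where "\<psi> \<in> borel_measurable borel" "\<And>x. \<phi> x \<le> \<psi> x"
    "(\<integral>\<^sup>+x. \<psi> x \<partial>lborel) = (\<integral>\<^sup>+x. \<phi> x \<partial>lebesgue)"
proof -
  obtain \<phi>' where \<phi>': "\<phi>' \<in> borel_measurable lborel" "AE x in lborel. \<phi> x = \<phi>' x"
    using completion_ex_borel_measurable[OF assms] by blast
  obtain N where N: "N \<in> null_sets lborel" "{x \<in> space lborel. \<phi> x \<noteq> \<phi>' x} \<subseteq> N"
    using AE_E[OF \<phi>'(2)] by (metis null_setsI)
  have eq: "\<phi> x = \<phi>' x" if "x \<notin> N" for x using N(2) that by auto
  have [measurable]: "N \<in> sets borel" "\<phi>' \<in> borel_measurable borel" using N \<phi>' by auto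
  show ?thesis
  proof (rule that[of "\<lambda>x. \<phi>' x + top * indicator N x"])
    show "\<phi> x \<le> \<phi>' x + top * indicator N x" for x
      by (cases "x \<in> N") (simp_all add: eq)
    have "(\<integral>\<^sup>+x. \<phi>' x + top * indicator N x \<partial>lborel) = (\<integral>\<^sup>+x. \<phi> x \<partial>lborel)"
      using \<phi>'(2) AE_not_in[OF N(1)] by (intro nn_integral_cong_AE) (auto elim: eventually_elim2)
    then show "(\<integral>\<^sup>+x. \<phi>' x + top * indicator N x \<partial>lborel) = (\<integral>\<^sup>+x. \<phi> x \<partial>lebesgue)"
      by (simp add: nn_integral_completion)
  qed measurable
qed


section \<open>The supremum over all combinations\<close>

lemma min_powr_le_h_fun:
  fixes f g :: "'a::real_vector \<Rightarrow> real"
  assumes f: "\<And>x. f x \<in> {0..1}" and g: "\<And>x. g x \<in> {0..1}" and l: "0 < l" "l < 1"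
    and t: "0 < t" "t < 1"
  shows "min (f x powr ((1 - t) / (1 - l))) (g y powr (t / l)) \<le> h_fun f g l ((1 - t) *\<^sub>R x + t *\<^sub>R y)"
proof -
  define z where "z = (1 - t) *\<^sub>R x + t *\<^sub>R y"
  define m where "m = (\<lambda>t (x, y). min (f x powr ((1 - t) / (1 - l))) (g y powr (t / l)))"
  define S where "S = (\<lambda>t. {(x, y). z = (1 - t) *\<^sub>R x + t *\<^sub>R y})"
  have m: "m s xy \<le> 1" if "s \<in> {0<..<1}" for s xy
    using powr_le1[of "(1 - s) / (1 - l)" "f (fst xy)"] that f[of "fst xy"] l
    by (auto simp: m_def min_le_iff_disj split: prod.split)
  have bdd: "bdd_above (m s ` S s)" if "s \<in> {0<..<1}" for s
    using m[OF that] by (intro bdd_aboveI2)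
  have "S s \<noteq> {}" for s
  proof -
    have "(z, z) \<in> S s" by (simp add: S_def scaleR_left_distrib[symmetric])
    then show ?thesis by blast
  qed
  then have le1: "(SUP xy\<in>S s. m s xy) \<le> 1" if "s \<in> {0<..<1}" for s
    using m[OF that] by (intro cSUP_least)
  have "m t (x, y) \<le> (SUP xy\<in>S t. m t xy)"
    using t by (intro cSUP_upper bdd) (auto simp: S_def z_def)
  also have "\<dots> \<le> (SUP s\<in>{0<..<1}. SUP xy\<in>S s. m s xy)"
    using t le1 by (intro cSUP_upper bdd_aboveI2[where M=1]) auto
  also have "\<dots> = h_fun f g l z" by (simp add: h_fun_def m_def S_def)
  finally show ?thesis by (simp add: m_def z_def)
qed

text \<open>With $t = l v / w$ the exponents are $(1-t)/(1-l) = u/w$ and $t/l = v/w$, which raise $e^{-1/u}$ and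
  $e^{-1/v}$ to the common value $e^{-1/w}$.\<close>

lemma exp_recip_less_h_fun:
  fixes f g :: "'a::real_vector \<Rightarrow> real"
  assumes f: "\<And>x. f x \<in> {0..1}" and g: "\<And>x. g x \<in> {0..1}" and l: "0 < l" "l < 1"
    and pos: "0 < u" "0 < v" and w: "w = (1 - l) * u + l * v"
    and fx: "exp (- (1 / u)) < f x" and gy: "exp (- (1 / v)) < g y"
  shows "exp (- (1 / w)) < h_fun f g l ((1 - l * v / w) *\<^sub>R x + (l * v / w) *\<^sub>R y)"
proof -
  define t where "t = l * v / w"
  have w0: "0 < w" using pos l by (simp add: w add_pos_pos)
  have t1: "1 - t = (1 - l) * u / w" using w0 by (simp add: t_def w field_simps)
  have t: "0 < t" "t < 1"
  proof -
    show "0 < t" using w0 l pos by (simp add: t_def)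
    have "0 < 1 - t" unfolding t1 using w0 l pos by simp
    then show "t < 1" by simp
  qed
  have "exp (- (1 / w)) = exp (- (1 / u)) powr ((1 - t) / (1 - l))"
    unfolding t1 using l pos w0 by (simp add: exp_powr_real)
  also have "\<dots> < f x powr ((1 - t) / (1 - l))"
    using fx l t by (intro powr_less_mono2) auto
  finally have 1: "exp (- (1 / w)) < f x powr ((1 - t) / (1 - l))" .
  have "exp (- (1 / w)) = exp (- (1 / v)) powr (t / l)"
    unfolding t_def using l pos w0 by (simp add: exp_powr_real)
  also have "\<dots> < g y powr (t / l)"
    using gy l t by (intro powr_less_mono2) auto
  finally have "exp (- (1 / w)) < min (f x powr ((1 - t) / (1 - l))) (g y powr (t / l))" using 1 by simp
  also have "\<dots> \<le> h_fun f g l ((1 - t) *\<^sub>R x + t *\<^sub>R y)"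
    by (rule min_powr_le_h_fun[OF f g l t])
  finally show ?thesis by (simp add: t_def)
qed

theorem theorem1p1:
  fixes f g :: "real ^ 'n \<Rightarrow> real" and l :: real
  assumes "f \<in> borel_measurable lebesgue" and "g \<in> borel_measurable lebesgue"
    and "\<And>x. f x \<in> {0..1}" and "\<And>x. g x \<in> {0..1}"
    and "0 < l" and "l < 1"
  shows "upper_nn_integral lebesgue (\<lambda>z. ennreal (h_fun f g l z)) \<ge>
     inverse (ennreal (1 - l) * inverse (\<integral>\<^sup>+ x. ennreal (f x) \<partial>lebesgue)
            + ennreal l * inverse (\<integral>\<^sup>+ x. ennreal (g x) \<partial>lebesgue))"
  unfolding upper_nn_integral_def
proof (rule INF_greatest)
  fix H :: "real ^ 'n \<Rightarrow> ennreal"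
  assume "H \<in> {H \<in> borel_measurable lebesgue. \<forall>x\<in>space lebesgue. ennreal (h_fun f g l x) \<le> H x}"
  then have H: "H \<in> borel_measurable lebesgue" "\<And>x. ennreal (h_fun f g l x) \<le> H x" by auto
  obtain f0 where f0: "f0 \<in> borel_measurable borel" "\<And>x. f0 x \<le> ennreal (f x)"
      "(\<integral>\<^sup>+x. f0 x \<partial>lborel) = (\<integral>\<^sup>+x. ennreal (f x) \<partial>lebesgue)"
    using lebesgue_borel_minorant[of "\<lambda>x. ennreal (f x)"] assms(1) by auto
  obtain g0 where g0: "g0 \<in> borel_measurable borel" "\<And>x. g0 x \<le> ennreal (g x)"
      "(\<integral>\<^sup>+x. g0 x \<partial>lborel) = (\<integral>\<^sup>+x. ennreal (g x) \<partial>lebesgue)"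
    using lebesgue_borel_minorant[of "\<lambda>x. ennreal (g x)"] assms(2) by auto
  obtain H0 where H0: "H0 \<in> borel_measurable borel" "\<And>x. H x \<le> H0 x"
      "(\<integral>\<^sup>+x. H0 x \<partial>lborel) = (\<integral>\<^sup>+x. H x \<partial>lebesgue)"
    using lebesgue_borel_majorant[OF H(1)] by auto
  note [measurable] = f0(1) g0(1) H0(1)
  \<comment> \<open>The layer-cake formula by levels $e^{-1/u} < 1$ sees only values up to 1, so \<open>H0\<close> is cut off there.\<close>
  have "inverse (ennreal (1 - l) * inverse (\<integral>\<^sup>+x. f0 x \<partial>lborel) + ennreal l * inverse (\<integral>\<^sup>+x. g0 x \<partial>lborel))
      \<le> (\<integral>\<^sup>+x. min (H0 x) 1 \<partial>lborel)"
  proof (rule ennreal_harmonic_mean_leI[OF assms(5,6)], rule nn_integral_harmonic_real[where f=f0 and g=g0])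
    show "f0 x \<le> 1" "g0 x \<le> 1" for x
      using f0(2)[of x] g0(2)[of x] assms(3)[of x] assms(4)[of x]
      by (auto intro: order_trans simp: ennreal_le_1)
    fix u v w x y assume uv: "0 < u" "0 < v" "w = (1 - l) * u + l * v"
      and fx: "ennreal (exp (- (1 / u))) < f0 x" and gy: "ennreal (exp (- (1 / v))) < g0 y"
    let ?z = "(1 - l * v / w) *\<^sub>R x + (l * v / w) *\<^sub>R y"
    have "exp (- (1 / u)) < f x" "exp (- (1 / v)) < g y"
      using less_le_trans[OF fx f0(2)] less_le_trans[OF gy g0(2)] by (simp_all add: ennreal_less_iff)
    then have "exp (- (1 / w)) < h_fun f g l ?z"
      by (rule exp_recip_less_h_fun[OF assms(3-6) uv])
    then have "ennreal (exp (- (1 / w))) < ennreal (h_fun f g l ?z)" by (simp add: ennreal_less_iff)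
    also have "\<dots> \<le> H0 ?z" using H(2) H0(2) by (rule order_trans)
    finally show "ennreal (exp (- (1 / w))) < min (H0 ?z) 1"
      using uv assms(5,6) by (simp add: add_pos_pos)
  qed (use assms(5,6) in auto)
  also have "\<dots> \<le> (\<integral>\<^sup>+x. H0 x \<partial>lborel)" by (intro nn_integral_mono) auto
  finally show "inverse (ennreal (1 - l) * inverse (\<integral>\<^sup>+ x. ennreal (f x) \<partial>lebesgue)
      + ennreal l * inverse (\<integral>\<^sup>+ x. ennreal (g x) \<partial>lebesgue)) \<le> (\<integral>\<^sup>+ x. H x \<partial>lebesgue)"
    by (simp only: f0(3) g0(3) H0(3))
qed

end
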